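(* Let $(\mathcal L,\ell_0,\Omega,\mathcal F,\mathcal T)$ be a $\rho$-ITS over the variables $\mathcal V$. Let $\emptyset\neq\mathcal T'\subseteq\mathcal T$ be such that $|\mathrm{fun}(\eta)|\le 1$ holds for every update $\eta$ of the transitions in $\mathcal T'$. Moreover, let $t\in\mathcal T'$ and let $\langle r_{\mathrm d},r_{\mathrm{tf}},r_{\mathrm f}\rangle$ be a function call ranking function for $t$ w.r.t. $\mathcal T'$. Then $\mathcal{RB}_{\mathrm{loc}}:\mathcal L_{\mathcal T'}\to\mathcal B$ is a local runtime bound for $t$ w.r.t. $\mathcal T'$, where for all $\ell\in\mathcal L_{\mathcal T'}$, $$\mathcal{RB}_{\mathrm{loc}}(\ell)=\lceil\lceil r_{\mathrm d}(\ell)\rceil\rceil+\lceil\lceil r_{\mathrm f}(\ell)\rceil\rceil\cdot\bigl(1+2\cdot\lceil\lceil r_{\mathrm d}(\ell)\rceil\rceil\bigr)\cdot\lceil\lceil r_{\mathrm{tf}}(\ell)\rceil\rceil^{\lceil\lceil r_{\mathrm f}(\ell)\rceil\rceil}.$$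
   Context: **Programs.** $\mathcal V$ is a finite set of program variables. A state is a map $\sigma:\mathcal V\to\mathbb Z$; $\Sigma$ is the set of states; $\bot\notin\Sigma$ is an extra "undefined" state. $|\sigma|$ is the state $v\mapsto|\sigma(v)|$. $[\![e]\!]_\sigma$ is the value of $e$ when each variable $v$ is replaced by $\sigma(v)$; for arithmetic expressions $[\![e]\!]_\bot=0$. A constraint is a finite conjunction of inequations $p_1<p_2$ with $p_1,p_2\in\mathbb Z[\mathcal V]$. A $\rho$-ITS is a tuple $(\mathcal L,\ell_0,\Omega,\mathcal F,\mathcal T)$: $\mathcal L$ is a finite set of locations with initial location $\ell_0$; $\mathcal F$ is a finite set of function calls $\ell(\zeta)$ with $\ell\in\mathcal L\setminus\{\ell_0\}$ and $\zeta:\mathcal V\to\mathbb Z[\mathcal V]$; $\Omega\subseteq\mathcal L$ is the set of return locations, each $\ell\in\Omega$ having a return variable $v_\ell\in\mathcal V$; $\mathcal T$ is a finite set of transitions $(\ell,\varphi,\eta,\ell')$ with start location $\ell\in\mathcal L$, target location $\ell'\in\mathcal L\setminus\{\ell_0\}$, guard $\varphi$ (a constraint) and update $\eta:\mathcal V\to\mathbb Z[\mathcal V\cup\mathcal F]$. $\mathrm{fun}(\eta)$ is the set of function calls occurring in $\eta$, and $\mathrm{fun}(t)=\mathrm{fun}(\eta)$ if $t$ has update $\eta$. **Evaluation.** Evaluation trees have nodes labeled with configurations from $\mathcal L\times(\Sigma\cup\{\bot\})$ and edges labeled with elements of $\mathcal T\cup\mathcal F$. - $t$-step $\mathbb T\prec_t\mathbb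 T'$ for $t=(\ell,\varphi,\eta,\ell')$: $\mathbb T$ has a leaf labeled $(\ell,\sigma)$ with $\sigma\in\Sigma$ and $[\![\varphi]\!]_\sigma=\mathtt{true}$. If $\mathrm{fun}(\eta)=\emptyset$, then $\mathbb T'$ arises by adding below this leaf an edge labeled $t$ to a new node $(\ell',\sigma')$ with $\sigma'(v)=[\![\eta(v)]\!]_\sigma$ for all $v$. If $\mathrm{fun}(\eta)=\{\rho_1,\dots,\rho_n\}$ with $n\ge1$ and $\rho_i=\ell_i(\zeta_i)$, then $\mathbb T'$ arises by adding below this leaf an edge labeled $t$ to a new node $(\ell',\bot)$ and, for each $i$, an edge labeled $\rho_i$ to a new node $(\ell_i,\sigma_i)$ with $\sigma_i(v)=[\![\zeta_i(v)]\!]_\sigma$ for all $v$. - $\varepsilon$-step $\mathbb T\prec_\varepsilon\mathbb T'$: $\mathbb T$ has a node $(\ell,\sigma)$ with an edge labeled $t=(\ell,\varphi,\eta,\ell')$ to a child $(\ell',\bot)$ and edges labeled $\rho_i=\ell_i(\zeta_i)$ to children $(\ell_i,\sigma_i)$ for the function calls $\rho_i\in\mathrm{fun}(\eta)$, and there are paths from each child $(\ell_i,\sigma_i)$ to some node $(\ell_i',\sigma_i')\in\Omega\times\Sigma$. Then $\mathbb T'$ arises by replacing the label $(\ell',\bot)$ by $(\ell',\sigma')$, where $\sigma'(v)=[\![\eta(v)[\rho_i/\sigma_i'(v_{\ell_i'})]]\!]_\sigma$ for all $v$. For $\mathcal T'\subseteq\mathcal T$, $\prec_{\mathcal T'\cup\{\varepsilon\}}$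 is the union of $\prec_\varepsilon$ and all $\prec_t$ with $t\in\mathcal T'$; $\prec^*$ denotes finitely many steps. $(\{(\ell,\sigma)\},\emptyset)$ is the single-node tree with label $(\ell,\sigma)$, and $\mathbb T_{\sigma_0}=(\{(\ell_0,\sigma_0)\},\emptyset)$. $|\mathbb T|_{\{t\}}$ is the number of edges of $\mathbb T$ labeled $t$. For $\vartheta\in\mathcal T\cup\mathcal F$, $(\ell,\sigma)\to_\vartheta(\ell',\sigma')$ is an evaluation step if there are $\sigma_0\in\Sigma$ and a tree $\mathbb T$ with $\mathbb T_{\sigma_0}\prec^*_{\mathcal T\cup\{\varepsilon\}}\mathbb T$ such that $\mathbb T$ contains an edge labeled $\vartheta$ from a node $(\ell,\sigma)$ to a node $(\ell',\sigma')$ (where $\sigma'$ may be $\bot$). **Bounds.** $\mathcal B$ is the smallest set containing $\mathbb N\cup\{\omega\}$ and $\mathcal V$ such that $b_1+b_2$, $\max(b_1,b_2)$, $b_1\cdot b_2$, $p^{b_1}$, $\log_k(b_1)$ are in $\mathcal B$ for all $b_1,b_2\in\mathcal B$, $p\in\mathbb N[\mathcal V]$, real $k>1$ (where $\log_k(b)$ stands for $\lceil\log_k(\max\{1,b\})\rceil$). For $p\in\mathbb Z[\mathcal V]$, $\lceil\lceil p\rceil\rceil\in\mathbb N[\mathcal V]$ arises from $p$ by replacing every coefficient by its absolute value. **Subprograms.** For $\emptyset\ne\mathcal T'\subseteq\mathcal T$: $\mathcal L_{\mathcal T'}$ is the set of start locations of transitions in $\mathcal T'$; $\mathrm{fun}(\mathcal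 T')=\bigcup_{t\in\mathcal T'}\mathrm{fun}(t)$; $\mathrm{fun}(\mathcal L_{\mathcal T'})$ is the set of all function calls $\ell(\zeta)\in\mathcal F$ with $\ell\in\mathcal L_{\mathcal T'}$; $\mathrm{trans}(\mathrm{fun}(\mathcal L_{\mathcal T'}))$ is the set of all transitions $t\in\mathcal T$ with $\mathrm{fun}(t)\cap\mathrm{fun}(\mathcal L_{\mathcal T'})\neq\emptyset$. **Local runtime bound.** For $t\in\mathcal T'$, $\mathcal{RB}_{\mathrm{loc}}:\mathcal L_{\mathcal T'}\to\mathcal B$ is a local runtime bound for $t$ w.r.t. $\mathcal T'$ if for all $\sigma_0\in\Sigma$, all $\ell\in\mathcal L_{\mathcal T'}$ and all $\mathbb T$ with $(\{(\ell,\sigma_0)\},\emptyset)\prec^*_{\mathcal T'\cup\{\varepsilon\}}\mathbb T$ we have $|\mathbb T|_{\{t\}}\le[\![\mathcal{RB}_{\mathrm{loc}}(\ell)]\!]_{|\sigma_0|}$. **Function call ranking function.** For $t\in\mathcal T'$, a triple $\langle r_{\mathrm d},r_{\mathrm{tf}},r_{\mathrm f}\rangle$ of functions $\mathcal L\to\mathbb Z[\mathcal V]$ is a function call ranking function for $t$ w.r.t. $\mathcal T'$ if for all evaluation steps $(\ell,\sigma)\to_\vartheta(\ell',\sigma')$ with $\vartheta\in\mathcal T'$ or $\vartheta\in\mathrm{fun}(\mathcal T')\cap\mathrm{fun}(\mathcal L_{\mathcal T'})$: (a) $[\![r_i(\ell)]\!]_\sigma\ge[\![r_i(\ell')]\!]_{\sigma'}$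 for all $i\in\{\mathrm d,\mathrm{tf},\mathrm f\}$; (b) if $\vartheta=t$ and $t\notin\mathrm{trans}(\mathrm{fun}(\mathcal L_{\mathcal T'}))$, then $[\![r_{\mathrm d}(\ell)]\!]_\sigma>[\![r_{\mathrm d}(\ell')]\!]_{\sigma'}$ and $[\![r_{\mathrm d}(\ell)]\!]_\sigma>0$; (c) if $\vartheta\in\mathcal T'\cap\mathrm{trans}(\mathrm{fun}(\mathcal L_{\mathcal T'}))$, then $[\![r_{\mathrm{tf}}(\ell)]\!]_\sigma>[\![r_{\mathrm{tf}}(\ell')]\!]_{\sigma'}$ and $[\![r_{\mathrm{tf}}(\ell)]\!]_\sigma>0$; (d) if $\vartheta\in\mathrm{fun}(\mathcal T')\cap\mathrm{fun}(\mathcal L_{\mathcal T'})$, then $[\![r_{\mathrm f}(\ell)]\!]_\sigma>[\![r_{\mathrm f}(\ell')]\!]_{\sigma'}$ and $[\![r_{\mathrm f}(\ell)]\!]_\sigma>0$.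
   Formalization: The local runtime bound is shown only for start configurations (ℓ,σ₀) occurring in a tree derived from some T_{σ₀'}; for unreachable ones the claim fails, e.g. an unguarded self-loop t at a location unreachable from ℓ₀ has ranking function 0 but unbounded local runtime. *)

theory Defs
  imports Complex_Main "HOL-Library.Poly_Mapping" "HOL-Library.Extended_Nat"
begin

section \<open>Multivariate polynomials\<close>

text \<open>A polynomial maps each monomial (an exponent vector) to its coefficient; the ring
  structure on this type is the one of \<^theory>\<open>HOL-Library.Poly_Mapping\<close>.\<close>

type_synonym ('x, 'a) mpoly = "('x \<Rightarrow>\<^sub>0 nat) \<Rightarrow>\<^sub>0 'a"

definition peval :: "('x \<Rightarrow> 'a::comm_semiring_1) \<Rightarrow> ('x, 'a) mpoly \<Rightarrow> 'a" where
  "peval s p = (\<Sum>m\<in>Poly_Mapping.keys p.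
     Poly_Mapping.lookup p m * (\<Prod>x\<in>Poly_Mapping.keys m. s x ^ Poly_Mapping.lookup m x))"

definition pvars :: "('x, 'a::zero) mpoly \<Rightarrow> 'x set" where
  "pvars p = (\<Union>m\<in>Poly_Mapping.keys p. Poly_Mapping.keys m)"

definition abs_poly :: "('x, int) mpoly \<Rightarrow> ('x, nat) mpoly" where
  "abs_poly p = Poly_Mapping.map (\<lambda>c. nat \<bar>c\<bar>) p"

section \<open>Integer transition systems with function calls\<close>

type_synonym 'v state = "'v \<Rightarrow> int"

datatype ('l, 'v) fcall = FCall (call_loc: 'l) (call_args: "'v \<Rightarrow> ('v, int) mpoly")

text \<open>A guard lists the inequations \<open>p < q\<close> as pairs \<open>(p, q)\<close>. An update is a polynomial over
  the disjoint union of variables (\<^const>\<open>Inl\<close>) and function calls (\<^const>\<open>Inr\<close>).\<close>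

datatype ('l, 'v) transition =
  Transition (src: 'l) (guard: "(('v, int) mpoly \<times> ('v, int) mpoly) list")
    (update: "'v \<Rightarrow> ('v + ('l, 'v) fcall, int) mpoly") (tgt: 'l)

definition guard_holds :: "(('v, int) mpoly \<times> ('v, int) mpoly) list \<Rightarrow> 'v state \<Rightarrow> bool" where
  "guard_holds g \<sigma> \<longleftrightarrow> (\<forall>(p, q) \<in> set g. peval \<sigma> p < peval \<sigma> q)"

definition upd_fun :: "('v \<Rightarrow> ('v + ('l, 'v) fcall, int) mpoly) \<Rightarrow> ('l, 'v) fcall set" where
  "upd_fun \<eta> = {\<rho>. \<exists>v. Inr \<rho> \<in> pvars (\<eta> v)}"

definition funs :: "('l, 'v) transition set \<Rightarrow> ('l, 'v) fcall set" where
  "funs S = (\<Union>t\<in>S. upd_fun (update t))"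

record ('l, 'v) its =
  locs :: "'l set"
  init :: 'l
  rets :: "'l set"
  ret_var :: "'l \<Rightarrow> 'v"
  fcalls :: "('l, 'v) fcall set"
  transs :: "('l, 'v) transition set"

definition rho_ITS :: "('l, 'v::finite) its \<Rightarrow> bool" where
  "rho_ITS P \<longleftrightarrow>
     finite (locs P) \<and> init P \<in> locs P \<and> rets P \<subseteq> locs P \<and>
     finite (fcalls P) \<and> (\<forall>\<rho>\<in>fcalls P. call_loc \<rho> \<in> locs P - {init P}) \<and>
     finite (transs P) \<and>
     (\<forall>t\<in>transs P. src t \<in> locs P \<and> tgt t \<in> locs P - {init P} \<and>
        upd_fun (update t) \<subseteq> fcalls P)"

section \<open>Evaluation trees\<close>

text \<open>The undefined state is \<^const>\<open>None\<close>. The edges leaving a node carry pairwise different labels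
  (one transition \<open>t\<close> and the distinct function calls of \<open>t\<close>), so a node is identified with the
  list of edge labels on the path from the root to it. A tree is the partial map from nodes to
  their configurations; the edges of \<open>T\<close> are the nonempty paths \<open>p @ [e]\<close> in \<open>dom T\<close>.\<close>

type_synonym ('l, 'v) edge = "('l, 'v) transition + ('l, 'v) fcall"
type_synonym ('l, 'v) config = "'l \<times> 'v state option"
type_synonym ('l, 'v) etree = "('l, 'v) edge list \<Rightarrow> ('l, 'v) config option"

definition root_tree :: "'l \<Rightarrow> 'v state \<Rightarrow> ('l, 'v) etree" where
  "root_tree l \<sigma> = [[] \<mapsto> (l, Some \<sigma>)]"

definition is_leaf :: "('l, 'v) etree \<Rightarrow> ('l, 'v) edge list \<Rightarrow> bool" where
  "is_leaf T p \<longleftrightarrow> p \<in> dom T \<and> (\<forall>e. p @ [e] \<notin> dom T)"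

text \<open>The nodes a \<open>t\<close>-step adds below a leaf with state \<open>\<sigma>\<close>, indexed by the label of the new
  edge. If \<open>t\<close> has no function calls, the valuation of calls is irrelevant.\<close>

fun new_child ::
  "('l, 'v) transition \<Rightarrow> 'v state \<Rightarrow> ('l, 'v) edge \<Rightarrow> ('l, 'v) config option" where
  "new_child t \<sigma> (Inl t') =
     (if t' \<noteq> t then None
      else if upd_fun (update t) = {}
        then Some (tgt t, Some (\<lambda>v. peval (case_sum \<sigma> (\<lambda>_. 0)) (update t v)))
      else Some (tgt t, None))"
| "new_child t \<sigma> (Inr \<rho>) =
     (if \<rho> \<in> upd_fun (update t)
      then Some (call_loc \<rho>, Some (\<lambda>v. peval \<sigma> (call_args \<rho> v)))
      else None)"

definition trans_step ::
  "('l, 'v) transition \<Rightarrow> ('l, 'v) etree \<Rightarrow> ('l, 'v) etree \<Rightarrow> bool" where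
  "trans_step t T T' \<longleftrightarrow>
     (\<exists>p \<sigma>. is_leaf T p \<and> T p = Some (src t, Some \<sigma>) \<and> guard_holds (guard t) \<sigma> \<and>
        T' = (\<lambda>q. if q \<noteq> [] \<and> butlast q = p then new_child t \<sigma> (last q) else T q))"

text \<open>The function \<open>w\<close> collects the returned values, one for each call \<open>\<rho>\<close> in the update. As in a
  tree every descendant of a node is reached by a unique path, a path from the child reached via
  \<open>\<rho>\<close> is given by its list \<open>q\<close> of edge labels.\<close>

definition eps_step ::
  "('l, 'v) its \<Rightarrow> ('l, 'v) etree \<Rightarrow> ('l, 'v) etree \<Rightarrow> bool" where
  "eps_step P T T' \<longleftrightarrow>
     (\<exists>p \<sigma> t w. T p = Some (src t, Some \<sigma>) \<and> T (p @ [Inl t]) = Some (tgt t, None) \<and>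
        (\<forall>\<rho>\<in>upd_fun (update t). p @ [Inr \<rho>] \<in> dom T \<and>
           (\<exists>q l' \<sigma>'. T (p @ [Inr \<rho>] @ q) = Some (l', Some \<sigma>') \<and> l' \<in> rets P \<and>
              w \<rho> = \<sigma>' (ret_var P l'))) \<and>
        T' = T(p @ [Inl t] \<mapsto> (tgt t, Some (\<lambda>v. peval (case_sum \<sigma> w) (update t v)))))"

definition step ::
  "('l, 'v) its \<Rightarrow> ('l, 'v) transition set \<Rightarrow> ('l, 'v) etree \<Rightarrow> ('l, 'v) etree \<Rightarrow> bool" where
  "step P S T T' \<longleftrightarrow> eps_step P T T' \<or> (\<exists>t\<in>S. trans_step t T T')"

text \<open>Trees obtained from a single node by finitely many steps are finite, so \<^const>\<open>card\<close> is the
  actual number of edges on all trees where it is used.\<close>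

definition edge_count :: "('l, 'v) transition \<Rightarrow> ('l, 'v) etree \<Rightarrow> nat" where
  "edge_count t T = card {p. p @ [Inl t] \<in> dom T}"

definition evaluation_step ::
  "('l, 'v) its \<Rightarrow> ('l, 'v) config \<Rightarrow> ('l, 'v) edge \<Rightarrow> ('l, 'v) config \<Rightarrow> bool" where
  "evaluation_step P c \<theta> c' \<longleftrightarrow>
     (\<exists>\<sigma>\<^sub>0 T p. (step P (transs P))\<^sup>*\<^sup>* (root_tree (init P) \<sigma>\<^sub>0) T \<and>
        T p = Some c \<and> T (p @ [\<theta>]) = Some c')"

definition reachable :: "('l, 'v) its \<Rightarrow> ('l \<times> 'v state) set" where
  "reachable P = {(l, \<sigma>). \<exists>\<sigma>\<^sub>0 T p.
     (step P (transs P))\<^sup>*\<^sup>* (root_tree (init P) \<sigma>\<^sub>0) T \<and> T p = Some (l, Some \<sigma>)}"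

section \<open>Bounds\<close>

text \<open>A bound is identified with its value as a function of a non-negative valuation of the
  variables. The elements of the first clause are the natural numbers and \<open>\<omega> = \<infinity>\<close>.\<close>

type_synonym 'v bound = "('v \<Rightarrow> nat) \<Rightarrow> enat"

definition epow :: "nat \<Rightarrow> enat \<Rightarrow> enat" where
  "epow n e = (case e of enat m \<Rightarrow> enat (n ^ m) | \<infinity> \<Rightarrow> if n \<le> 1 then enat n else \<infinity>)"

definition elog :: "real \<Rightarrow> enat \<Rightarrow> enat" where
  "elog k e = (case e of enat m \<Rightarrow> enat (nat \<lceil>log k (max 1 (real m))\<rceil>) | \<infinity> \<Rightarrow> \<infinity>)"

inductive_set bounds :: "'v bound set" where
  const: "(\<lambda>_. c) \<in> bounds"
| var: "(\<lambda>s. enat (s v)) \<in> bounds"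
| add: "b \<in> bounds \<Longrightarrow> b' \<in> bounds \<Longrightarrow> (\<lambda>s. b s + b' s) \<in> bounds"
| max: "b \<in> bounds \<Longrightarrow> b' \<in> bounds \<Longrightarrow> (\<lambda>s. max (b s) (b' s)) \<in> bounds"
| mult: "b \<in> bounds \<Longrightarrow> b' \<in> bounds \<Longrightarrow> (\<lambda>s. b s * b' s) \<in> bounds"
| pow: "b \<in> bounds \<Longrightarrow> (\<lambda>s. epow (peval s p) (b s)) \<in> bounds"
| log: "b \<in> bounds \<Longrightarrow> k > 1 \<Longrightarrow> (\<lambda>s. elog k (b s)) \<in> bounds"

definition abs_state :: "'v state \<Rightarrow> 'v \<Rightarrow> nat" where
  "abs_state \<sigma> v = nat \<bar>\<sigma> v\<bar>"

section \<open>Subprograms, local runtime bounds and ranking functions\<close>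

definition start_locs :: "('l, 'v) transition set \<Rightarrow> 'l set" where
  "start_locs S = src ` S"

definition fun_locs :: "('l, 'v) its \<Rightarrow> 'l set \<Rightarrow> ('l, 'v) fcall set" where
  "fun_locs P L = {\<rho>\<in>fcalls P. call_loc \<rho> \<in> L}"

definition trans_fun :: "('l, 'v) its \<Rightarrow> ('l, 'v) fcall set \<Rightarrow> ('l, 'v) transition set" where
  "trans_fun P R = {t\<in>transs P. upd_fun (update t) \<inter> R \<noteq> {}}"

text \<open>The parameter \<open>C\<close> restricts the start configurations of the subprogram. Ranking functions
  (below) are only constrained on evaluation steps, i.e. on steps in evaluations that start in
  the initial location. Hence they yield no bound for \<open>C = UNIV\<close>: if a location that is not
  reachable has an unguarded self-loop \<open>t\<close>, then \<open>0\<close> is a ranking function for \<open>t\<close>, but \<open>t\<close> can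
  be iterated from there. The appropriate choice is \<open>C = reachable P\<close>.\<close>

definition local_runtime_bound_on ::
  "('l, 'v) its \<Rightarrow> ('l \<times> 'v state) set \<Rightarrow> ('l, 'v) transition \<Rightarrow> ('l, 'v) transition set \<Rightarrow>
   ('l \<Rightarrow> 'v bound) \<Rightarrow> bool" where
  "local_runtime_bound_on P C t S RB \<longleftrightarrow>
     (\<forall>l\<in>start_locs S. RB l \<in> bounds) \<and>
     (\<forall>\<sigma>\<^sub>0. \<forall>l\<in>start_locs S. (l, \<sigma>\<^sub>0) \<in> C \<longrightarrow>
        (\<forall>T. (step P S)\<^sup>*\<^sup>* (root_tree l \<sigma>\<^sub>0) T \<longrightarrow>
           enat (edge_count t T) \<le> RB l (abs_state \<sigma>\<^sub>0)))"

fun cval :: "('l \<Rightarrow> ('v, int) mpoly) \<Rightarrow> ('l, 'v) config \<Rightarrow> int" where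
  "cval r (l, Some \<sigma>) = peval \<sigma> (r l)"
| "cval r (l, None) = 0"

definition call_ranking_function ::
  "('l, 'v) its \<Rightarrow> ('l, 'v) transition \<Rightarrow> ('l, 'v) transition set \<Rightarrow>
   ('l \<Rightarrow> ('v, int) mpoly) \<Rightarrow> ('l \<Rightarrow> ('v, int) mpoly) \<Rightarrow> ('l \<Rightarrow> ('v, int) mpoly) \<Rightarrow> bool" where
  "call_ranking_function P t S rd rtf rf \<longleftrightarrow>
     (let FL = fun_locs P (start_locs S); TF = trans_fun P FL in
      \<forall>c \<theta> c'. evaluation_step P c \<theta> c' \<and> \<theta> \<in> Inl ` S \<union> Inr ` (funs S \<inter> FL) \<longrightarrow>
        (\<forall>r\<in>{rd, rtf, rf}. cval r c \<ge> cval r c') \<and>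
        (\<theta> = Inl t \<and> t \<notin> TF \<longrightarrow> cval rd c > cval rd c' \<and> cval rd c > 0) \<and>
        (\<theta> \<in> Inl ` (S \<inter> TF) \<longrightarrow> cval rtf c > cval rtf c' \<and> cval rtf c > 0) \<and>
        (\<theta> \<in> Inr ` (funs S \<inter> FL) \<longrightarrow> cval rf c > cval rf c' \<and> cval rf c > 0))"

end

theory Submission
  imports Defs
begin

text \<open>Every evaluation of the subprogram from a reachable configuration can be grafted onto a leaf
  of an evaluation of the whole program. Hence all edges of the local evaluation tree are evaluation
  steps, and the ranking functions apply to them. Then \<open>r\<^sub>f\<close> bounds the number of nested
  calls, \<open>r\<^sub>t\<^sub>f\<close> bounds the number of calls issued along a path without call edges, and \<open>r\<^sub>d\<close> the
  number of \<open>t\<close>-edges on such a path. As every transition has at most one call, the number of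
  call-free paths is at most \<open>\<Sum>i\<le>r\<^sub>f. r\<^sub>t\<^sub>f ^ i\<close>.\<close>

section \<open>Polynomials and bounds\<close>

lemma abs_prod_int: "\<bar>prod f A\<bar> = (\<Prod>x\<in>A. \<bar>f x :: int\<bar>)"
  by (induction A rule: infinite_finite_induct) (auto simp: abs_mult)

lemma peval_le_abs_poly:
  "peval \<sigma> p \<le> int (peval (abs_state \<sigma>) (abs_poly p))"
proof -
  \<comment> \<open>Taking absolute values turns no coefficient into 0, so both sums range over the
    same monomials.\<close>
  have keys: "Poly_Mapping.keys (abs_poly p) = Poly_Mapping.keys p"
    by (auto simp: abs_poly_def in_keys_iff map.rep_eq when_def)
  have "peval \<sigma> p \<le> (\<Sum>m\<in>Poly_Mapping.keys p. \<bar>Poly_Mapping.lookup p m *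
      (\<Prod>x\<in>Poly_Mapping.keys m. \<sigma> x ^ Poly_Mapping.lookup m x)\<bar>)"
    unfolding peval_def by (rule sum_mono) simp
  also have "\<dots> = int (peval (abs_state \<sigma>) (abs_poly p))"
    unfolding peval_def keys of_nat_sum
    by (rule sum.cong) (auto simp: abs_poly_def map.rep_eq when_def abs_mult abs_prod_int power_abs
        abs_state_def in_keys_iff)
  finally show ?thesis .
qed

text \<open>The clause \<open>pow\<close> admits every polynomial over the naturals as a base, so
  exponent 1 yields the polynomial itself.\<close>

lemma peval_in_bounds: "(\<lambda>s. enat (peval s p)) \<in> bounds"
proof -
  have "(\<lambda>s. epow (peval s p) 1) \<in> bounds"
    by (intro bounds.pow bounds.const)
  then show ?thesis
    by (simp add: epow_def one_enat_def)
qed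

section \<open>Estimates for the geometric sums that count call-free paths\<close>

lemma geometric_sum_mono:
  fixes b b' c c' :: nat
  assumes "b \<le> b'" "c \<le> c'"
  shows "(\<Sum>i\<le>c. b ^ i) \<le> (\<Sum>i\<le>c'. b' ^ i)"
proof -
  have "(\<Sum>i\<le>c. b ^ i) \<le> (\<Sum>i\<le>c. b' ^ i)"
    by (intro sum_mono power_mono assms) simp
  also have "\<dots> \<le> (\<Sum>i\<le>c'. b' ^ i)"
    by (rule sum_mono2) (use assms in auto)
  finally show ?thesis .
qed

text \<open>Horner's rule turns the sum into 1 plus \<open>b\<close> times the shorter sum, while
  \<open>Suc b ^ Suc c\<close> splits into \<open>Suc b ^ c + b * Suc b ^ c\<close>.\<close>

lemma geometric_sum_le_Suc_power:
  fixes b :: nat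
  shows "(\<Sum>i\<le>c. b ^ i) \<le> Suc b ^ c"
proof (induction c)
  case (Suc c)
  have "(\<Sum>i\<le>Suc c. b ^ i) = 1 + b * (\<Sum>i\<le>c. b ^ i)"
    by (simp add: sum.atMost_Suc_shift sum_distrib_left del: sum.atMost_Suc)
  also have "\<dots> \<le> Suc b ^ c + b * Suc b ^ c"
    using Suc by (intro add_mono mult_le_mono) auto
  finally show ?case by simp
qed simp

text \<open>This is the recurrence for the number of paths at a calling transition: the continuation
  lowers the base, the callee lowers the largest exponent. The single term \<open>b ^ c\<close>
  absorbs the continuation, the terms with smaller exponents absorb the callee.\<close>

lemma geometric_sum_split:
  fixes b1 b2 b c1 c2 c :: nat
  assumes "b1 < b" "b2 \<le> b" "c1 \<le> c" "c2 < c"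
  shows "(\<Sum>i\<le>c1. b1 ^ i) + (\<Sum>i\<le>c2. b2 ^ i) \<le> (\<Sum>i\<le>c. b ^ i)"
proof -
  obtain b' c' where eq: "b = Suc b'" "c = Suc c'"
    using assms by (metis less_imp_Suc_add)
  have "(\<Sum>i\<le>c1. b1 ^ i) \<le> (\<Sum>i\<le>c. b' ^ i)"
    by (rule geometric_sum_mono) (use assms eq in auto)
  also have "\<dots> \<le> b ^ c"
    unfolding eq by (rule geometric_sum_le_Suc_power)
  finally have "(\<Sum>i\<le>c1. b1 ^ i) \<le> b ^ c" .
  moreover have "(\<Sum>i\<le>c2. b2 ^ i) \<le> (\<Sum>i\<le>c'. b ^ i)"
    by (rule geometric_sum_mono) (use assms eq in auto)
  ultimately show ?thesis
    by (simp add: eq)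
qed

text \<open>For positive \<open>b\<close>, each term with exponent between 1 and \<open>c\<close> is
  at most \<open>b ^ c\<close>; for \<open>b = 0\<close> only exponent 0 contributes.\<close>

lemma geometric_sum_le:
  fixes b :: nat
  shows "(\<Sum>i\<le>c. b ^ i) \<le> 1 + c * b ^ c"
proof (cases "b = 0")
  case False
  have "(\<Sum>i\<in>{1..c}. b ^ i) \<le> (\<Sum>i\<in>{1..c}. b ^ c)"
    using False by (intro sum_mono power_increasing) auto
  moreover have "(\<Sum>i\<le>c. b ^ i) = 1 + (\<Sum>i\<in>{1..c}. b ^ i)"
    by (simp add: sum.atLeast1_atMost_eq lessThan_Suc_atMost[symmetric] sum.lessThan_Suc_shift
        del: sum.lessThan_Suc)
  ultimately show ?thesis by simp
qed (simp add: power_0_left)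

section \<open>Structure of evaluation trees\<close>

text \<open>Finiteness of the variable type keeps trees finite under transition steps. It also gives
  bounds on \<open>card (upd_fun \<eta>)\<close> their intended meaning, as \<open>card\<close> is 0
  on infinite sets.\<close>

lemma finite_upd_fun:
  fixes \<eta> :: "'v::finite \<Rightarrow> ('v + ('l, 'v) fcall, int) mpoly"
  shows "finite (upd_fun \<eta>)"
proof -
  have "upd_fun \<eta> = (\<Union>v. Inr -` pvars (\<eta> v))"
    by (auto simp: upd_fun_def)
  moreover have "finite (pvars (\<eta> v))" for v
    by (simp add: pvars_def)
  ultimately show ?thesis
    by (auto intro!: finite_vimageI)
qed

text \<open>Invariant of all trees built with transitions from \<open>S\<close>: an inner node has a
  defined state and exactly one transition edge, accompanied by one edge for each call of that
  transition. No condition ties the label of a node to the transition leading to it, because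
  epsilon-steps relabel such nodes. Nor is the root label prescribed, so subtrees inherit the
  invariant.\<close>

definition eval_tree :: "('l, 'v) transition set \<Rightarrow> ('l, 'v) etree \<Rightarrow> bool" where
  "eval_tree S T \<longleftrightarrow> finite (dom T) \<and>
     (\<forall>p t. p @ [Inl t] \<in> dom T \<longrightarrow> t \<in> S \<and> (\<exists>\<sigma>. T p = Some (src t, Some \<sigma>)) \<and>
        (\<forall>\<rho>. p @ [Inr \<rho>] \<in> dom T \<longleftrightarrow> \<rho> \<in> upd_fun (update t)) \<and>
        (\<forall>t'. p @ [Inl t'] \<in> dom T \<longrightarrow> t' = t)) \<and>
     (\<forall>p \<rho>. p @ [Inr \<rho>] \<in> dom T \<longrightarrow> (\<exists>t. p @ [Inl t] \<in> dom T) \<and>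
        (\<exists>s. T (p @ [Inr \<rho>]) = Some (call_loc \<rho>, s)))"

lemma eval_tree_finite: "eval_tree S T \<Longrightarrow> finite (dom T)"
  by (simp add: eval_tree_def)

lemma eval_tree_Inl:
  assumes "eval_tree S T" "p @ [Inl t] \<in> dom T"
  shows "t \<in> S" "\<exists>\<sigma>. T p = Some (src t, Some \<sigma>)"
    "p @ [Inr \<rho>] \<in> dom T \<longleftrightarrow> \<rho> \<in> upd_fun (update t)"
    "p @ [Inl t'] \<in> dom T \<Longrightarrow> t' = t"
  using assms unfolding eval_tree_def by blast+

lemma eval_tree_Inr:
  assumes "eval_tree S T" "p @ [Inr \<rho>] \<in> dom T"
  shows "\<exists>t. p @ [Inl t] \<in> dom T" "\<exists>s. T (p @ [Inr \<rho>]) = Some (call_loc \<rho>, s)"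
  using assms unfolding eval_tree_def by blast+

lemma eval_tree_edge:
  assumes "eval_tree S T" "p @ [e] \<in> dom T"
  obtains t where "p @ [Inl t] \<in> dom T"
  using assms eval_tree_Inr(1) by (cases e) blast+

lemma eval_tree_parent:
  assumes "eval_tree S T" "p @ [e] \<in> dom T"
  shows "\<exists>l \<sigma>. T p = Some (l, Some \<sigma>)"
  using assms by (meson eval_tree_edge eval_tree_Inl(2))

lemma eval_tree_prefix:
  assumes "eval_tree S T" "p @ q \<in> dom T"
  shows "p \<in> dom T"
  using assms(2)
proof (induction q rule: rev_induct)
  case (snoc e q)
  then show ?case
    using eval_tree_parent[OF assms(1), of "p @ q" e] by auto
qed simp

lemma new_child_dom:
  "(\<exists>c. new_child t \<sigma> e = Some c) \<longleftrightarrow> e = Inl t \<or> e \<in> Inr ` upd_fun (update t)"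
  by (cases e) auto

lemma eval_tree_trans_step:
  fixes T :: "('l, 'v::finite) etree"
  assumes "eval_tree S T" "t \<in> S" "trans_step t T T'"
  shows "eval_tree S T'"
proof -
  obtain p \<sigma> where leaf: "is_leaf T p" and p: "T p = Some (src t, Some \<sigma>)"
    and T': "T' = (\<lambda>q. if q \<noteq> [] \<and> butlast q = p then new_child t \<sigma> (last q) else T q)"
    using assms(3) unfolding trans_step_def by blast
  have snoc: "T' (q @ [e]) = (if q = p then new_child t \<sigma> e else T (q @ [e]))" for q e
    by (simp add: T')
  \<comment> \<open>All nodes with parent \<open>p\<close> are new, because \<open>p\<close> was a
    leaf.\<close>
  have old: "T' q = T q" if "q \<in> dom T" for q
  proof (cases q rule: rev_cases)
    case (snoc q' e)
    then show ?thesis using that leaf by (auto simp: T' is_leaf_def)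
  qed (simp add: T')
  have dom_snoc: "q @ [e] \<in> dom T' \<longleftrightarrow>
      (if q = p then e = Inl t \<or> e \<in> Inr ` upd_fun (update t) else q @ [e] \<in> dom T)" for q e
    using new_child_dom[of t \<sigma> e] by (auto simp: snoc dom_def)
  have "dom T' \<subseteq> dom T \<union> (\<lambda>e. p @ [e]) ` ({Inl t} \<union> Inr ` upd_fun (update t))"
  proof
    fix q assume "q \<in> dom T'"
    then show "q \<in> dom T \<union> (\<lambda>e. p @ [e]) ` ({Inl t} \<union> Inr ` upd_fun (update t))"
    proof (cases q rule: rev_cases)
      case Nil
      with \<open>q \<in> dom T'\<close> show ?thesis by (simp add: T' dom_def)
    next
      case (snoc q' e)
      with \<open>q \<in> dom T'\<close> show ?thesis using dom_snoc[of q' e] by (cases "q' = p") auto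
    qed
  qed
  then have "finite (dom T')"
    by (rule finite_subset) (use assms(1) in \<open>simp add: finite_upd_fun eval_tree_finite\<close>)
  moreover have "t' \<in> S \<and> (\<exists>\<sigma>. T' q = Some (src t', Some \<sigma>)) \<and>
        (\<forall>\<rho>. q @ [Inr \<rho>] \<in> dom T' \<longleftrightarrow> \<rho> \<in> upd_fun (update t')) \<and>
        (\<forall>t''. q @ [Inl t''] \<in> dom T' \<longrightarrow> t'' = t')" if "q @ [Inl t'] \<in> dom T'" for q t'
  proof (cases "q = p")
    case True
    with that have "t' = t" by (auto simp: dom_snoc)
    with True show ?thesis using assms(2) p old[of p] by (auto simp: dom_snoc)
  next
    case False
    with that have "q @ [Inl t'] \<in> dom T" by (simp add: dom_snoc)
    note * = eval_tree_Inl[OF assms(1) this]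
    then have "T' q = T q" by (intro old) auto
    with * False show ?thesis by (simp add: dom_snoc)
  qed
  moreover have "(\<exists>t'. q @ [Inl t'] \<in> dom T') \<and> (\<exists>s. T' (q @ [Inr \<rho>]) = Some (call_loc \<rho>, s))"
    if "q @ [Inr \<rho>] \<in> dom T'" for q \<rho>
  proof (cases "q = p")
    case True
    with that have "\<rho> \<in> upd_fun (update t)" by (auto simp: dom_snoc)
    with True show ?thesis by (auto simp: dom_snoc snoc)
  next
    case False
    with that have "q @ [Inr \<rho>] \<in> dom T" by (simp add: dom_snoc)
    from eval_tree_Inr[OF assms(1) this] False show ?thesis by (simp add: dom_snoc snoc)
  qed
  ultimately show ?thesis unfolding eval_tree_def by blast
qed

lemma eval_tree_eps_step:
  assumes "eval_tree S T" "eps_step P T T'"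
  shows "eval_tree S T'"
proof -
  obtain p t \<sigma> where p: "T (p @ [Inl t]) = Some (tgt t, None)"
    and T': "T' = T(p @ [Inl t] \<mapsto> (tgt t, Some \<sigma>))"
    using assms(2) unfolding eps_step_def by blast
  have dom: "dom T' = dom T" using p by (auto simp: T')
  \<comment> \<open>The relabelled node had an undefined state and hence no outgoing edges, so no
    parent of an edge changes its label.\<close>
  have parent: "T' q = T q" if "q @ [e] \<in> dom T" for q e
    using eval_tree_parent[OF assms(1) that] p by (auto simp: T')
  have call: "T' (q @ [Inr \<rho>]) = T (q @ [Inr \<rho>])" for q \<rho>
    by (simp add: T')
  have "t' \<in> S \<and> (\<exists>\<sigma>. T' q = Some (src t', Some \<sigma>)) \<and>
        (\<forall>\<rho>. q @ [Inr \<rho>] \<in> dom T \<longleftrightarrow> \<rho> \<in> upd_fun (update t')) \<and>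
        (\<forall>t''. q @ [Inl t''] \<in> dom T \<longrightarrow> t'' = t')" if "q @ [Inl t'] \<in> dom T" for q t'
    using eval_tree_Inl[OF assms(1) that] parent[OF that] by auto
  then show ?thesis
    using eval_tree_finite[OF assms(1)] eval_tree_Inr[OF assms(1)]
    unfolding eval_tree_def dom call by blast
qed

lemma eval_tree_step:
  fixes T :: "('l, 'v::finite) etree"
  assumes "eval_tree S T" "step P S T T'"
  shows "eval_tree S T'"
  using assms eval_tree_trans_step eval_tree_eps_step unfolding step_def by blast

lemma eval_tree_root: "eval_tree S (root_tree l \<sigma>)"
  by (simp add: eval_tree_def root_tree_def)

lemma eval_tree_steps:
  fixes T :: "('l, 'v::finite) etree"
  assumes "(step P S)\<^sup>*\<^sup>* (root_tree l \<sigma>) T"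
  shows "eval_tree S T"
  using assms by induction (auto intro: eval_tree_root eval_tree_step)

text \<open>Transition steps only write to nonempty paths, and epsilon-steps only to nodes entered
  by a transition edge, so the root is never touched.\<close>

lemma root_label_steps:
  assumes "(step P S)\<^sup>*\<^sup>* (root_tree l \<sigma>) T"
  shows "T [] = Some (l, Some \<sigma>)"
  using assms
  by induction (auto simp: root_tree_def step_def trans_step_def eps_step_def)

section \<open>Grafting local evaluations\<close>

text \<open>A node receives a defined label only while it is a leaf, and this label never changes.\<close>

lemma reachable_leaf:
  fixes T :: "('l, 'v::finite) etree"
  assumes "(step P S)\<^sup>*\<^sup>* (root_tree l\<^sub>0 \<sigma>\<^sub>0) T" "T p = Some (l, Some \<sigma>)"
  shows "\<exists>T'. (step P S)\<^sup>*\<^sup>* (root_tree l\<^sub>0 \<sigma>\<^sub>0) T' \<and> is_leaf T' p \<and> T' p = Some (l, Some \<sigma>)"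
  using assms
proof (induction arbitrary: p)
  case base
  then show ?case
    by (intro exI[of _ "root_tree l\<^sub>0 \<sigma>\<^sub>0"])
      (auto simp: root_tree_def is_leaf_def split: if_splits)
next
  case (step T T')
  have tree: "eval_tree S T"
    using step.hyps(1) by (rule eval_tree_steps)
  show ?case
  proof (cases "T p = T' p")
    case True
    with step.IH step.prems show ?thesis by simp
  next
    case False
    \<comment> \<open>A node whose label has just changed was undefined or absent before. In both
      cases it had no children, so \<open>T'\<close> itself is the witness.\<close>
    have "T' (p @ [e]) = None" for e
      using step.hyps(2) unfolding step_def
    proof (elim disjE bexE)
      assume "eps_step P T T'"
      then obtain q t \<sigma>' where q: "T (q @ [Inl t]) = Some (tgt t, None)"
        and T': "T' = T(q @ [Inl t] \<mapsto> (tgt t, Some \<sigma>'))"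
        unfolding eps_step_def by blast
      from False have "p = q @ [Inl t]" by (auto simp: T' split: if_splits)
      then have "p @ [e] \<notin> dom T" using eval_tree_parent[OF tree, of p e] q by auto
      then show ?thesis using \<open>p = q @ [Inl t]\<close> by (auto simp: T')
    next
      fix t assume "trans_step t T T'"
      then obtain q \<sigma>' where leaf: "is_leaf T q"
        and T': "T' = (\<lambda>r. if r \<noteq> [] \<and> butlast r = q then new_child t \<sigma>' (last r) else T r)"
        unfolding trans_step_def by blast
      from False have "p \<noteq> [] \<and> butlast p = q" by (auto simp: T' split: if_splits)
      then have p: "p = q @ [last p]" by auto
      then have "p \<notin> dom T" using leaf by (metis is_leaf_def)
      then have "p @ [e] \<notin> dom T" using eval_tree_prefix[OF tree] by blast
      moreover have "p \<noteq> q" using p by (metis append_self_conv list.distinct(1))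
      ultimately show ?thesis by (auto simp: T')
    qed
    then have "is_leaf T' p" using step.prems by (auto simp: is_leaf_def)
    with step show ?thesis by (meson rtranclp.rtrancl_into_rtrancl)
  qed
qed

definition graft :: "('l, 'v) etree \<Rightarrow> ('l, 'v) edge list \<Rightarrow> ('l, 'v) etree \<Rightarrow> ('l, 'v) etree" where
  "graft T p T1 = (\<lambda>q. if \<exists>r. q = p @ r then T1 (drop (length p) q) else T q)"

lemma graft_append [simp]: "graft T p T1 (p @ r) = T1 r"
  by (simp add: graft_def)

lemma graft_other: "\<nexists>r. q = p @ r \<Longrightarrow> graft T p T1 q = T q"
  by (simp add: graft_def)

text \<open>The start of the simulation: grafting the initial local tree onto a leaf with the same
  label changes nothing, so the global evaluation can simply be continued.\<close>

lemma graft_root: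
  assumes "eval_tree S T" "is_leaf T p" "T p = Some (l, Some \<sigma>)"
  shows "graft T p (root_tree l \<sigma>) = T"
proof
  fix q
  show "graft T p (root_tree l \<sigma>) q = T q"
  proof (cases "\<exists>r. q = p @ r")
    case True
    then obtain r where r: "q = p @ r" by blast
    have "T q = None" if "r = e # r'" for e r'
      using assms(2) eval_tree_prefix[OF assms(1), of "p @ [e]" r'] that
      by (auto simp: is_leaf_def r)
    then show ?thesis using assms(3) r graft_append[of T p _ r] by (cases r) (auto simp: root_tree_def)
  qed (simp add: graft_other)
qed

lemma trans_step_graft:
  assumes "trans_step t T1 T2"
  shows "trans_step t (graft T p T1) (graft T p T2)"
proof -
  obtain q \<sigma> where leaf: "is_leaf T1 q" and q: "T1 q = Some (src t, Some \<sigma>)"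
    and g: "guard_holds (guard t) \<sigma>"
    and T2: "T2 = (\<lambda>r. if r \<noteq> [] \<and> butlast r = q then new_child t \<sigma> (last r) else T1 r)"
    using assms unfolding trans_step_def by blast
  have "is_leaf (graft T p T1) (p @ q)"
    using leaf by (auto simp: is_leaf_def domIff)
  moreover have "graft T p T2 = (\<lambda>r. if r \<noteq> [] \<and> butlast r = p @ q then new_child t \<sigma> (last r)
      else graft T p T1 r)" (is "_ = ?G")
  proof
    fix r
    show "graft T p T2 r = ?G r"
    proof (cases "\<exists>r'. r = p @ r'")
      case True
      then obtain r' where r': "r = p @ r'" by blast
      show ?thesis
      proof (cases "r' = []")
        case True
        \<comment> \<open>The grafting point itself is not one of the new children:
          \<open>butlast p\<close> is shorter than \<open>p\<close>.\<close>
        have "\<not> (p \<noteq> [] \<and> butlast p = p @ q)"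
          by (metis append_butlast_last_id append_self_conv append.assoc list.distinct(1)
              append_is_Nil_conv)
        with True show ?thesis by (auto simp: r' T2 graft_append[of T p _ "[]", simplified])
      qed (simp add: r' T2 butlast_append)
    next
      case False
      then have "\<not> (r \<noteq> [] \<and> butlast r = p @ q)"
        by (metis append.assoc append_butlast_last_id)
      with False show ?thesis by (auto simp: graft_other)
    qed
  qed
  ultimately show ?thesis
    unfolding trans_step_def using q g by (intro exI[of _ "p @ q"] exI[of _ \<sigma>]) simp
qed

lemma graft_update: "graft T p (T1(q \<mapsto> c)) = (graft T p T1)(p @ q \<mapsto> c)"
  by (rule ext) (auto simp: graft_def)

text \<open>An epsilon-step inspects only the node it works at and its descendants. Prefixing all
  paths by \<open>p\<close> therefore preserves the return nodes, and the same returned values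
  \<open>w\<close> can be used.\<close>

lemma eps_step_graft:
  assumes "eps_step P T1 T2"
  shows "eps_step P (graft T p T1) (graft T p T2)"
proof -
  obtain q \<sigma> t w where *: "T1 q = Some (src t, Some \<sigma>)" "T1 (q @ [Inl t]) = Some (tgt t, None)"
      "\<forall>\<rho>\<in>upd_fun (update t). q @ [Inr \<rho>] \<in> dom T1 \<and>
           (\<exists>r l' \<sigma>'. T1 (q @ [Inr \<rho>] @ r) = Some (l', Some \<sigma>') \<and> l' \<in> rets P \<and>
              w \<rho> = \<sigma>' (ret_var P l'))"
    and T2: "T2 = T1(q @ [Inl t] \<mapsto> (tgt t, Some (\<lambda>v. peval (case_sum \<sigma> w) (update t v))))"
    using assms unfolding eps_step_def by blast
  show ?thesis
    unfolding eps_step_def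
    by (rule exI[of _ "p @ q"], rule exI[of _ \<sigma>], rule exI[of _ t], rule exI[of _ w])
      (use * in \<open>simp add: T2 graft_update domIff\<close>)
qed

lemma steps_graft:
  assumes "(step P S)\<^sup>*\<^sup>* T1 T2" "S \<subseteq> S'"
  shows "(step P S')\<^sup>*\<^sup>* (graft T p T1) (graft T p T2)"
  using assms(1)
proof induction
  case (step T2 T3)
  have "step P S' (graft T p T2) (graft T p T3)"
    using step.hyps(2) assms(2) unfolding step_def
    by (meson eps_step_graft trans_step_graft subsetD)
  with step.IH show ?case by simp
qed simp

lemma local_evaluation_step:
  fixes P :: "('l, 'v::finite) its"
  assumes "(l, \<sigma>) \<in> reachable P" "S \<subseteq> transs P" "(step P S)\<^sup>*\<^sup>* (root_tree l \<sigma>) T"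
    and "T q = Some c" "T (q @ [e]) = Some c'"
  shows "evaluation_step P c e c'"
proof -
  obtain \<sigma>\<^sub>0 T\<^sub>0 p where "(step P (transs P))\<^sup>*\<^sup>* (root_tree (init P) \<sigma>\<^sub>0) T\<^sub>0"
      "T\<^sub>0 p = Some (l, Some \<sigma>)"
    using assms(1) unfolding reachable_def by blast
  \<comment> \<open>In \<open>T\<^sub>0\<close> the node \<open>p\<close> may already have
    descendants; an earlier tree in which it is still a leaf leaves room for the local
    evaluation.\<close>
  from reachable_leaf[OF this] obtain T' where
    T': "(step P (transs P))\<^sup>*\<^sup>* (root_tree (init P) \<sigma>\<^sub>0) T'" "is_leaf T' p"
      "T' p = Some (l, Some \<sigma>)"
    by blast
  have "(step P (transs P))\<^sup>*\<^sup>* T' (graft T' p T)"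
    using steps_graft[OF assms(3,2), of T' p] graft_root[OF eval_tree_steps[OF T'(1)] T'(2,3)]
    by simp
  then have "(step P (transs P))\<^sup>*\<^sup>* (root_tree (init P) \<sigma>\<^sub>0) (graft T' p T)"
    using T'(1) by simp
  then show ?thesis
    unfolding evaluation_step_def using assms(4,5)
    by (intro exI[of _ \<sigma>\<^sub>0] exI[of _ "graft T' p T"] exI[of _ "p @ q"]) simp
qed

section \<open>Counting edges\<close>

definition subtree :: "('l, 'v) edge \<Rightarrow> ('l, 'v) etree \<Rightarrow> ('l, 'v) etree" where
  "subtree e T = (\<lambda>q. T (e # q))"

lemma dom_subtree: "dom (subtree e T) = {q. e # q \<in> dom T}"
  by (auto simp: subtree_def)

lemma finite_dom_subtree:
  assumes "finite (dom T)"
  shows "finite (dom (subtree e T))"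
proof -
  have "dom (subtree e T) = (#) e -` dom T" by (auto simp: subtree_def)
  then show ?thesis using assms by (simp add: finite_vimageI)
qed

lemma eval_tree_subtree:
  assumes "eval_tree S T"
  shows "eval_tree S (subtree e T)"
  using assms finite_dom_subtree[OF eval_tree_finite[OF assms], of e]
  unfolding eval_tree_def dom_subtree mem_Collect_eq
  by (simp add: subtree_def flip: append_Cons)

lemma card_subtree_less:
  assumes "finite (dom T)" "[] \<in> dom T"
  shows "card (dom (subtree e T)) < card (dom T)"
proof -
  have "card (dom (subtree e T)) = card ((#) e ` dom (subtree e T))"
    by (simp add: card_image)
  also have "\<dots> < card (dom T)"
    by (rule psubset_card_mono) (use assms in \<open>auto simp: dom_subtree\<close>)
  finally show ?thesis .
qed

lemma edge_count_no_children:
  assumes "eval_tree S T" "\<And>e. [e] \<notin> dom T"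
  shows "edge_count t T = 0"
proof -
  have "p @ [Inl t] \<notin> dom T" for p
    using eval_tree_prefix[OF assms(1), of "[hd (p @ [Inl t])]" "tl (p @ [Inl t])"] assms(2)
    by (metis append_Cons append_Nil list.collapse snoc_eq_iff_butlast)
  then show ?thesis by (simp add: edge_count_def)
qed

text \<open>An edge is counted via the path to its source: the empty path stands for an edge at the
  root, a path \<open>e # q\<close> for an edge of the subtree below \<open>e\<close>.\<close>

lemma edge_count_le_subtrees:
  fixes T :: "('l, 'v) etree"
  assumes "eval_tree S T" "{e. [e] \<in> dom T} \<subseteq> E" "finite E"
  shows "edge_count t T \<le> of_bool ([Inl t] \<in> dom T) + (\<Sum>e\<in>E. edge_count t (subtree e T))"
proof -
  let ?A = "\<lambda>T. {p. p @ [Inl t] \<in> dom T}"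
  have fin: "finite (?A (subtree e T))" for e
  proof -
    have "?A (subtree e T) = (\<lambda>p. p @ [Inl t]) -` dom (subtree e T)" by auto
    then show ?thesis
      using finite_dom_subtree[OF eval_tree_finite[OF assms(1)]]
      by (simp add: finite_vimageI inj_on_def)
  qed
  let ?R = "if [Inl t] \<in> dom T then {[] :: ('l, 'v) edge list} else {}"
  have "?A T \<subseteq> ?R \<union> (\<Union>e\<in>E. (#) e ` ?A (subtree e T))"
  proof
    fix p assume p: "p \<in> ?A T"
    show "p \<in> ?R \<union> (\<Union>e\<in>E. (#) e ` ?A (subtree e T))"
    proof (cases p)
      case (Cons e q)
      have "[e] \<in> dom T"
        using eval_tree_prefix[OF assms(1), of "[e]" "q @ [Inl t]"] p Cons by simp
      then have "e \<in> E" using assms(2) by auto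
      with p Cons show ?thesis by (auto simp: subtree_def)
    qed (use p in auto)
  qed
  then have "edge_count t T \<le> card (?R \<union> (\<Union>e\<in>E. (#) e ` ?A (subtree e T)))"
    unfolding edge_count_def by (rule card_mono[rotated]) (use assms(3) fin in auto)
  also have "\<dots> \<le> card ?R + card (\<Union>e\<in>E. (#) e ` ?A (subtree e T))"
    by (rule card_Un_le)
  also have "\<dots> \<le> card ?R + (\<Sum>e\<in>E. card ((#) e ` ?A (subtree e T)))"
    using card_UN_le[OF assms(3)] by (intro add_left_mono)
  also have "\<dots> = of_bool ([Inl t] \<in> dom T) + (\<Sum>e\<in>E. edge_count t (subtree e T))"
    by (simp add: edge_count_def card_image)
  finally show ?thesis .
qed

text \<open>The ranking conditions for a single edge, with arbitrary integer measures on
  configurations. Unlike \<open>evaluation_step\<close>, they do not refer to an evaluation from the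
  initial location, so they pass to subtrees and support induction on trees.\<close>

definition ranked_edge ::
  "('l, 'v) transition \<Rightarrow> ('l, 'v) transition set \<Rightarrow> ('l, 'v) fcall set \<Rightarrow>
   (('l, 'v) config \<Rightarrow> int) \<Rightarrow> (('l, 'v) config \<Rightarrow> int) \<Rightarrow> (('l, 'v) config \<Rightarrow> int) \<Rightarrow>
   ('l, 'v) config \<Rightarrow> ('l, 'v) edge \<Rightarrow> ('l, 'v) config \<Rightarrow> bool" where
  "ranked_edge t S F rd rtf rf c e c' \<longleftrightarrow>
     (e \<in> Inl ` S \<union> Inr ` F \<longrightarrow> rd c' \<le> rd c \<and> rtf c' \<le> rtf c \<and> rf c' \<le> rf c) \<and>
     (e = Inl t \<and> upd_fun (update t) \<inter> F = {} \<longrightarrow> rd c' < rd c \<and> 0 < rd c) \<and>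
     (\<forall>t'\<in>S. e = Inl t' \<and> upd_fun (update t') \<inter> F \<noteq> {} \<longrightarrow> rtf c' < rtf c \<and> 0 < rtf c) \<and>
     (e \<in> Inr ` F \<longrightarrow> rf c' < rf c \<and> 0 < rf c)"

definition all_edges ::
  "(('l, 'v) config \<Rightarrow> ('l, 'v) edge \<Rightarrow> ('l, 'v) config \<Rightarrow> bool) \<Rightarrow> ('l, 'v) etree \<Rightarrow> bool" where
  "all_edges R T \<longleftrightarrow> (\<forall>q e c c'. T q = Some c \<longrightarrow> T (q @ [e]) = Some c' \<longrightarrow> R c e c')"

lemma all_edges_subtree: "all_edges R T \<Longrightarrow> all_edges R (subtree e T)"
  unfolding all_edges_def subtree_def by (metis append_Cons)

lemma all_edges_root: "all_edges R T \<Longrightarrow> T [] = Some c \<Longrightarrow> T [e] = Some c' \<Longrightarrow> R c e c'"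
  unfolding all_edges_def by (metis append_Nil)

text \<open>If \<open>t\<close> itself issues relevant calls, then \<open>r\<^sub>d\<close> need not decrease; in this case every \<open>t\<close>-edge
  starts a new call-free path, so \<open>t\<close> occurs less often than there are such paths.\<close>

lemma edge_count_ranked:
  fixes T :: "('l, 'v::finite) etree"
  assumes "eval_tree S T" "all_edges (ranked_edge t S F rd rtf rf) T" "T [] = Some c"
    and single: "\<forall>t'\<in>S. card (upd_fun (update t')) \<le> 1"
    and calls: "\<And>\<rho>. \<rho> \<in> funs S \<Longrightarrow> call_loc \<rho> \<in> start_locs S \<Longrightarrow> \<rho> \<in> F"
  shows "edge_count t T + of_bool (upd_fun (update t) \<inter> F \<noteq> {}) \<le>
    (if upd_fun (update t) \<inter> F \<noteq> {} then 1 else nat (rd c)) * (\<Sum>i\<le>nat (rf c). nat (rtf c) ^ i)"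
  using assms(1-3)
proof (induction "card (dom T)" arbitrary: T c rule: less_induct)
  case less
  note tree = less.prems(1) and ranked = less.prems(2) and root = less.prems(3)
  define calling :: bool where "calling \<longleftrightarrow> upd_fun (update t) \<inter> F \<noteq> {}"
  \<comment> \<open>\<open>H c\<close> bounds the number of call-free paths and \<open>k c\<close>
    is the charge per path: the number of \<open>t\<close>-edges on it, or 1 if \<open>t\<close>
    itself calls, since then each \<open>t\<close>-edge pays for a new path.\<close>
  define k where "k c = (if calling then 1 else nat (rd c))" for c
  define H where "H c = (\<Sum>i\<le>nat (rf c). nat (rtf c) ^ i)" for c
  have H1: "1 \<le> H c" for c
    using geometric_sum_mono[of 0 "nat (rtf c)" 0 "nat (rf c)"] by (simp add: H_def)
  have IH: "edge_count t (subtree e T) + of_bool calling \<le> k c' * H c'"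
    if "T [e] = Some c'" for e c'
    unfolding k_def H_def calling_def
  proof (rule less.hyps)
    show "card (dom (subtree e T)) < card (dom T)"
      using eval_tree_finite[OF tree] root by (intro card_subtree_less) auto
    show "subtree e T [] = Some c'"
      using that by (simp add: subtree_def)
  qed (use tree ranked in \<open>simp_all add: eval_tree_subtree all_edges_subtree\<close>)
  have "edge_count t T + of_bool calling \<le> k c * H c"
  proof (cases "\<exists>e. [e] \<in> dom T")
    case False
    then have "edge_count t T = 0"
      using edge_count_no_children[OF tree] by blast
    \<comment> \<open>If \<open>calling\<close> holds, the summand 1 on the left is covered by the
      one path consisting of the root.\<close>
    then show ?thesis using H1[of c] by (auto simp: k_def)
  next
    case True
    then obtain t' where t': "[Inl t'] \<in> dom T"
      using eval_tree_edge[OF tree, of "[]"] by (metis append_Nil)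
    note node = eval_tree_Inl[OF tree, of "[]", unfolded append_Nil, OF t']
    let ?R = "upd_fun (update t')"
    obtain c1 where c1: "T [Inl t'] = Some c1" using t' by auto
    note rank1 = all_edges_root[OF ranked root c1, unfolded ranked_edge_def]
    have le1: "rd c1 \<le> rd c" "rtf c1 \<le> rtf c" "rf c1 \<le> rf c"
      using rank1 node(1) by auto
    have children: "{e. [e] \<in> dom T} = insert (Inl t') (Inr ` ?R)"
    proof (intro set_eqI)
      fix e
      have "[e] \<in> dom T \<longleftrightarrow> e \<in> insert (Inl t') (Inr ` ?R)"
      proof (cases e)
        case (Inl t'')
        have "[Inl t''] \<in> dom T \<longleftrightarrow> t'' = t'" using node(4) t' by blast
        then show ?thesis by (simp add: Inl image_iff)
      next
        case (Inr \<rho>)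
        show ?thesis by (simp add: Inr image_iff node(3))
      qed
      then show "e \<in> {e. [e] \<in> dom T} \<longleftrightarrow> e \<in> insert (Inl t') (Inr ` ?R)" by simp
    qed
    have "edge_count t T \<le> of_bool ([Inl t] \<in> dom T) +
        (\<Sum>e\<in>insert (Inl t') (Inr ` ?R). edge_count t (subtree e T))"
      by (rule edge_count_le_subtrees[OF tree]) (simp_all add: children finite_upd_fun)
    also have "[Inl t] \<in> dom T \<longleftrightarrow> t = t'"
      using node(4) t' by blast
    also have "(\<Sum>e\<in>insert (Inl t') (Inr ` ?R). edge_count t (subtree e T)) =
        edge_count t (subtree (Inl t') T) + (\<Sum>\<rho>\<in>?R. edge_count t (subtree (Inr \<rho>) T))"
      by (subst sum.insert) (auto simp: finite_upd_fun sum.reindex)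
    finally have count: "edge_count t T \<le> of_bool (t = t') +
        (edge_count t (subtree (Inl t') T) + (\<Sum>\<rho>\<in>?R. edge_count t (subtree (Inr \<rho>) T)))" .
    show ?thesis
    proof (cases "?R \<inter> F = {}")
      case True
      \<comment> \<open>A call outside \<open>F\<close> starts at a location where no transition of
        \<open>S\<close> begins, so its subtree has no edges.\<close>
      have "edge_count t (subtree (Inr \<rho>) T) = 0" if "\<rho> \<in> ?R" for \<rho>
      proof (rule edge_count_no_children[OF eval_tree_subtree[OF tree]])
        fix e
        show "[e] \<notin> dom (subtree (Inr \<rho>) T)"
        proof
          assume "[e] \<in> dom (subtree (Inr \<rho>) T)"
          then have "[Inr \<rho>] @ [e] \<in> dom T" by (auto simp: subtree_def)
          then obtain t'' where "[Inr \<rho>] @ [Inl t''] \<in> dom T"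
            using eval_tree_edge[OF tree] by blast
          note * = eval_tree_Inl(1,2)[OF tree this]
          moreover have "[] @ [Inr \<rho>] \<in> dom T"
            using that children by auto
          ultimately have "call_loc \<rho> = src t''"
            using eval_tree_Inr(2)[OF tree, of "[]" \<rho>] by auto
          then have "\<rho> \<in> F"
            using calls[of \<rho>] * node(1) that by (auto simp: funs_def start_locs_def)
          with True that show False by auto
        qed
      qed
      with count have "edge_count t T + of_bool calling \<le> of_bool (t = t') + k c1 * H c1"
        using IH[OF c1] by simp
      also have "H c1 \<le> H c"
        unfolding H_def by (intro geometric_sum_mono nat_mono le1)
      \<comment> \<open>If \<open>t\<close> is taken here, it issues no relevant call, so
        \<open>rd\<close> drops and frees a whole summand \<open>H c\<close>, which is at least
        1.\<close>
      also have "of_bool (t = t') + k c1 * H c \<le> k c * H c"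
      proof (cases "t = t'")
        case t: True
        with True have "\<not> calling" by (simp add: calling_def)
        moreover have "Suc (nat (rd c1)) \<le> nat (rd c)"
          using rank1 t True by auto
        ultimately have "Suc (k c1) * H c \<le> k c * H c"
          by (intro mult_right_mono) (simp_all add: k_def)
        with t H1[of c] show ?thesis by simp
      next
        case False
        have "k c1 \<le> k c" using le1 by (simp add: k_def nat_mono)
        with False show ?thesis by simp
      qed
      finally show ?thesis by simp
    next
      case False
      have "is_singleton ?R"
        using single node(1) False finite_upd_fun[of "update t'"]
        by (metis card_0_eq inf_bot_left is_singleton_altdef le_less less_one)
      then obtain \<rho> where R: "?R = {\<rho>}" by (auto simp: is_singleton_def)
      with False have \<rho>: "\<rho> \<in> F" by auto
      have "[Inr \<rho>] \<in> dom T" using children R by auto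
      then obtain c2 where c2: "T [Inr \<rho>] = Some c2" by auto
      note rank2 = all_edges_root[OF ranked root c2, unfolded ranked_edge_def]
      have le2: "rd c2 \<le> rd c" "rtf c2 \<le> rtf c" "rf c2 < rf c" "0 < rf c"
        using rank2 \<rho> by auto
      \<comment> \<open>The continuation \<open>c1\<close> loses in \<open>rtf\<close> and the
        callee \<open>c2\<close> loses in \<open>rf\<close>, exactly as the recurrence for geometric
        sums demands.\<close>
      have "rtf c1 < rtf c" "0 < rtf c"
        using rank1 node(1) False by auto
      then have split: "H c1 + H c2 \<le> H c"
        unfolding H_def using le1 le2 by (intro geometric_sum_split) auto
      \<comment> \<open>The node branches into two paths, so the right-hand side below contains
        \<open>of_bool calling\<close> twice; the second copy pays for the edge at the root if that
        is a \<open>t\<close>-edge.\<close>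
      have "t = t' \<Longrightarrow> calling"
        using False by (simp add: calling_def)
      then have "edge_count t T + of_bool calling \<le> (edge_count t (subtree (Inl t') T) + of_bool calling)
          + (edge_count t (subtree (Inr \<rho>) T) + of_bool calling)"
        using count by (auto simp: R of_bool_def split: if_splits)
      also have "\<dots> \<le> k c1 * H c1 + k c2 * H c2"
        by (intro add_mono IH c1 c2)
      also have "\<dots> \<le> k c * H c1 + k c * H c2"
        using le1 le2 by (intro add_mono mult_right_mono) (auto simp: k_def nat_mono)
      also have "\<dots> \<le> k c * H c"
        using split by (simp flip: distrib_left)
      finally show ?thesis .
    qed
  qed
  then show ?case
    by (simp only: k_def H_def calling_def)
qed

section \<open>From the path count to the closed form of the local runtime bound\<close>

theorem theorem22:
  fixes P :: "('l, 'v::finite) its"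
    and S :: "('l, 'v) transition set"
    and t :: "('l, 'v) transition"
    and rd rtf rf :: "'l \<Rightarrow> ('v, int) mpoly"
  assumes "rho_ITS P"
    and "S \<noteq> {}" and "S \<subseteq> transs P"
    and "\<forall>t'\<in>S. card (upd_fun (update t')) \<le> 1"
    and "t \<in> S"
    and "call_ranking_function P t S rd rtf rf"
  shows "local_runtime_bound_on P (reachable P) t S
    (\<lambda>l s. enat (peval s (abs_poly (rd l)))
       + enat (peval s (abs_poly (rf l)))
         * (1 + 2 * enat (peval s (abs_poly (rd l))))
         * epow (peval s (abs_poly (rtf l))) (enat (peval s (abs_poly (rf l)))))"
proof -
  let ?D = "\<lambda>l s. peval s (abs_poly (rd l))" and ?B = "\<lambda>l s. peval s (abs_poly (rtf l))"
    and ?C = "\<lambda>l s. peval s (abs_poly (rf l))"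
  define F where "F = fun_locs P (start_locs S)"
  have TF: "t' \<in> trans_fun P F \<longleftrightarrow> upd_fun (update t') \<inter> F \<noteq> {}" if "t' \<in> S" for t'
    using that assms(3) by (auto simp: trans_fun_def)
  have calls: "\<rho> \<in> F" if "\<rho> \<in> funs S" "call_loc \<rho> \<in> start_locs S" for \<rho>
    using that assms(1,3) by (auto simp: F_def fun_locs_def funs_def rho_ITS_def)
  have "enat (edge_count t T) \<le> enat (?D l (abs_state \<sigma>)) + enat (?C l (abs_state \<sigma>))
      * (1 + 2 * enat (?D l (abs_state \<sigma>)))
      * epow (?B l (abs_state \<sigma>)) (enat (?C l (abs_state \<sigma>)))"
    if reach: "(l, \<sigma>) \<in> reachable P" and steps: "(step P S)\<^sup>*\<^sup>* (root_tree l \<sigma>) T" for l \<sigma> T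
  proof -
    let ?d = "?D l (abs_state \<sigma>)" and ?b = "?B l (abs_state \<sigma>)" and ?f = "?C l (abs_state \<sigma>)"
    \<comment> \<open>The decrease of \<open>rf\<close> is guaranteed only for calls issued by
      \<open>S\<close>, hence the restriction of \<open>F\<close> to \<open>funs S\<close>. For
      transitions of \<open>S\<close> this does not affect which calls count as relevant.\<close>
    let ?c = "(l, Some \<sigma>)" and ?calling = "upd_fun (update t) \<inter> (F \<inter> funs S) \<noteq> {}"
    note tree = eval_tree_steps[OF steps]
    have "all_edges (ranked_edge t S (F \<inter> funs S) (cval rd) (cval rtf) (cval rf)) T"
      unfolding all_edges_def
    proof (intro allI impI)
      fix q e c c'
      assume "T q = Some c" "T (q @ [e]) = Some c'"
      then have "evaluation_step P c e c'"
        using local_evaluation_step[OF reach assms(3) steps] by blast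
      then have "e \<in> Inl ` S \<union> Inr ` (funs S \<inter> F) \<longrightarrow>
          (\<forall>r\<in>{rd, rtf, rf}. cval r c \<ge> cval r c') \<and>
          (e = Inl t \<and> t \<notin> trans_fun P F \<longrightarrow> cval rd c > cval rd c' \<and> cval rd c > 0) \<and>
          (e \<in> Inl ` (S \<inter> trans_fun P F) \<longrightarrow> cval rtf c > cval rtf c' \<and> cval rtf c > 0) \<and>
          (e \<in> Inr ` (funs S \<inter> F) \<longrightarrow> cval rf c > cval rf c' \<and> cval rf c > 0)"
        using assms(6) unfolding call_ranking_function_def Let_def F_def by blast
      moreover have "upd_fun (update t') \<inter> (F \<inter> funs S) = upd_fun (update t') \<inter> F"
        if "t' \<in> S" for t'
        using that by (auto simp: funs_def)
      ultimately show "ranked_edge t S (F \<inter> funs S) (cval rd) (cval rtf) (cval rf) c e c'"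
        unfolding ranked_edge_def
        using assms(5) TF by (cases e) (auto simp: Int_commute[of F "funs S"])
    qed
    from edge_count_ranked[OF tree this root_label_steps[OF steps] assms(4)]
    have "edge_count t T + of_bool ?calling \<le> (if ?calling then 1 else nat (peval \<sigma> (rd l)))
        * (\<Sum>i\<le>nat (peval \<sigma> (rf l)). nat (peval \<sigma> (rtf l)) ^ i)"
      using calls by (simp only: cval.simps) blast
    also have "\<dots> \<le> (if ?calling then 1 else ?d) * (\<Sum>i\<le>?f. ?b ^ i)"
      using peval_le_abs_poly[of \<sigma>]
      by (intro mult_le_mono geometric_sum_mono) (simp_all add: nat_le_iff)
    also have "\<dots> \<le> (if ?calling then 1 else ?d) * (1 + ?f * ?b ^ ?f)"
      by (intro mult_left_mono geometric_sum_le) simp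
    \<comment> \<open>If \<open>?calling\<close> holds, the 1 on the left cancels the 1 of the
      estimate, leaving \<open>?f * ?b ^ ?f\<close>. Otherwise the product expands to
      \<open>?d + ?d * ?f * ?b ^ ?f\<close>. Both are below the claimed bound.\<close>
    finally have "edge_count t T \<le> ?d + ?f * (1 + 2 * ?d) * ?b ^ ?f"
      by (cases ?calling) (simp_all add: algebra_simps)
    then show ?thesis
      by (simp add: epow_def one_enat_def numeral_eq_enat)
  qed
  moreover have "(\<lambda>s. enat (?D l s) + enat (?C l s) * (1 + 2 * enat (?D l s))
      * epow (?B l s) (enat (?C l s))) \<in> bounds" for l
    by (intro bounds.add bounds.mult bounds.pow peval_in_bounds bounds.const)
  ultimately show ?thesis
    unfolding local_runtime_bound_on_def by blast
qed

end
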